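(* Let $P=I-L^+L$ be a time-independent boundary projection. Suppose the initial data $f\in V$ satisfies the boundary condition $Lf=g(0)$. Then the semidiscrete approximation $$v_t+PQ\bigl(Pv+(I-P)\tilde g\bigr)=(I-P)\tilde g_t,\quad t>0,\qquad v(0)=f, \tag{A}$$ and the simplified semidiscrete approximation $$w_t+PQ\bigl(w+L^+g\bigr)=0,\quad t>0,\qquad w(0)=Pf, \tag{B}$$ are equivalent, in the following sense: if $v$ solves (A), then $w=Pv$ solves (B) and $v=w+L^+g$ for $t\ge0$; conversely, if $w$ solves (B), then $w=Pw$ and $v=w+L^+g$ solves (A).
   Context: $V=\mathbb{R}^{(N+1)d}$ is the state space with inner product $(u,v)=u^THv$, $H$ symmetric positive definite; $V_\Gamma=\mathbb{R}^{2d}$ is the boundary state space with the Euclidean inner product. $L:V\to V_\Gamma$ is a linear boundary operator, not necessarily of full rank, with pseudoinverse $L^+$ (the unique linear operator with $LL^+L=L$, $L^+LL^+=L^+$, and $L^+L$, $LL^+$ self-adjoint in the respective inner products). $Q:V\to V$ is a linear operator (a discretization of a spatial differential operator). $g(t)\in V_\Gamma$ is boundary data, and $\tilde g(t)\in V$ is a function, continuous for $t\ge0$ and differentiable for $t>0$, with $L\tilde g(t)=g(t)$ for all $t\ge 0$; thus $(I-P)\tilde g=L^+L\tilde g=L^+g$. Solutions $v,w:[0,\infty)\to V$ are continuous for $t\ge0$ and differentiable for $t>0$; subscript $t$ denotes the time derivative. *)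

theory Defs
  imports "HOL-Analysis.Analysis"
begin

text \<open>
  A state is a grid function with values in \<open>\<real>\<^sup>d\<close>. The grid points are indexed by a finite type
  \<open>'n\<close> with \<open>N + 1\<close> elements and the components by a finite type \<open>'d\<close> with \<open>d\<close> elements, so the
  state space has dimension \<open>(N + 1) d\<close> and the boundary state space has dimension \<open>2 d\<close>.
\<close>

type_synonym ('n, 'd) state = "real ^ ('n \<times> 'd)"
type_synonym 'd bstate = "real ^ (2 \<times> 'd)"

definition spd_matrix :: "real ^ 'm::finite ^ 'm \<Rightarrow> bool" where
  "spd_matrix H \<longleftrightarrow> transpose H = H \<and> (\<forall>x. x \<noteq> 0 \<longrightarrow> x \<bullet> (H *v x) > 0)"

definition weighted_inner :: "real ^ 'm::finite ^ 'm \<Rightarrow> real ^ 'm \<Rightarrow> real ^ 'm \<Rightarrow> real" where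
  "weighted_inner H u v = u \<bullet> (H *v v)"

definition self_adjoint_wrt :: "('a \<Rightarrow> 'a \<Rightarrow> real) \<Rightarrow> ('a \<Rightarrow> 'a) \<Rightarrow> bool" where
  "self_adjoint_wrt ip A \<longleftrightarrow> (\<forall>u v. ip (A u) v = ip u (A v))"

definition is_pseudoinverse ::
    "real ^ 'm::finite ^ 'm \<Rightarrow> (real ^ 'm \<Rightarrow> real ^ 'k::finite) \<Rightarrow> (real ^ 'k \<Rightarrow> real ^ 'm) \<Rightarrow> bool" where
  "is_pseudoinverse H L M \<longleftrightarrow>
     linear M \<and> L \<circ> M \<circ> L = L \<and> M \<circ> L \<circ> M = M \<and>
     self_adjoint_wrt (weighted_inner H) (M \<circ> L) \<and> self_adjoint_wrt (\<bullet>) (L \<circ> M)"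

definition pseudoinverse ::
    "real ^ 'm::finite ^ 'm \<Rightarrow> (real ^ 'm \<Rightarrow> real ^ 'k::finite) \<Rightarrow> real ^ 'k \<Rightarrow> real ^ 'm" where
  "pseudoinverse H L = (THE M. is_pseudoinverse H L M)"

text \<open>
  Functions of time are total functions on \<open>real\<close>, but only their values for \<open>t \<ge> 0\<close> matter.
\<close>

definition regular_in_time :: "(real \<Rightarrow> 'a::real_normed_vector) \<Rightarrow> bool" where
  "regular_in_time u \<longleftrightarrow> continuous_on {0..} u \<and> (\<forall>t>0. u differentiable (at t))"

definition solves_projected ::
    "('a::real_normed_vector \<Rightarrow> 'a) \<Rightarrow> ('a \<Rightarrow> 'a) \<Rightarrow> (real \<Rightarrow> 'a) \<Rightarrow> 'a \<Rightarrow> (real \<Rightarrow> 'a) \<Rightarrow> bool" where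
  "solves_projected P Q gt f v \<longleftrightarrow>
     regular_in_time v \<and>
     (\<forall>t>0. vector_derivative v (at t) + P (Q (P (v t) + (gt t - P (gt t)))) =
        vector_derivative gt (at t) - P (vector_derivative gt (at t))) \<and>
     v 0 = f"

definition solves_simplified ::
    "('a::real_normed_vector \<Rightarrow> 'a) \<Rightarrow> ('a \<Rightarrow> 'a) \<Rightarrow> ('b \<Rightarrow> 'a) \<Rightarrow> (real \<Rightarrow> 'b) \<Rightarrow> 'a \<Rightarrow> (real \<Rightarrow> 'a) \<Rightarrow> bool" where
  "solves_simplified P Q Lp g f w \<longleftrightarrow>
     regular_in_time w \<and>
     (\<forall>t>0. vector_derivative w (at t) + P (Q (w t + Lp (g t))) = 0) \<and>
     w 0 = P f"

text \<open>
  The definite description in the definition of \<open>pseudoinverse\<close> is justified by the existence and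
  uniqueness of the weighted pseudoinverse of a linear map.
\<close>

lemma weighted_orthogonal_decomposition:
  fixes H :: "real ^ 'm::finite ^ 'm"
  assumes H: "spd_matrix H" and K: "subspace K"
  obtains k x where "u = k + x" "k \<in> K" "\<And>s. s \<in> K \<Longrightarrow> weighted_inner H s x = 0"
proof -
  have pd: "x = 0" if "x \<bullet> (H *v x) = 0" for x
    using H that unfolding spd_matrix_def by force
  have sym: "(H *v s) \<bullet> t = s \<bullet> (H *v t)" for s t
    using H by (metis spd_matrix_def dot_lmul_matrix matrix_vector_mul_linear
        vector_transpose_matrix inner_commute)
  define T where "T = {t. \<forall>s\<in>K. weighted_inner H s t = 0}"
  have sT: "subspace T"
    by (auto simp: T_def subspace_def weighted_inner_def matrix_vector_right_distrib inner_add_right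
        matrix_vector_mult_scaleR)
  have inj: "inj_on ((*v) H) (span K)"
  proof (rule inj_onI)
    fix x y assume "H *v x = H *v y"
    then have "H *v (x - y) = 0" by (simp add: matrix_vector_mult_diff_distrib)
    then show "x = y" using pd[of "x - y"] by simp
  qed
  have "T = {y \<in> UNIV. \<forall>x \<in> (*v) H ` K. orthogonal x y}"
    by (auto simp: T_def weighted_inner_def orthogonal_def sym)
  moreover have "subspace ((*v) H ` K)"
    by (intro linear_subspace_image K matrix_vector_mul_linear)
  ultimately have "dim T + dim ((*v) H ` K) = dim (UNIV :: (real ^ 'm) set)"
    using dim_subspace_orthogonal_to_vectors[of "(*v) H ` K" UNIV] by simp
  moreover have "dim ((*v) H ` K) = dim K"
    by (rule dim_image_eq[OF matrix_vector_mul_linear inj])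
  moreover have "K \<inter> T = {0}"
    using pd subspace_0[OF K] subspace_0[OF sT] by (auto simp: T_def weighted_inner_def)
  moreover have "dim {x + y |x y. x \<in> K \<and> y \<in> T} + dim (K \<inter> T) = dim K + dim T"
    by (rule dim_sums_Int[OF K sT])
  ultimately have "dim {x + y |x y. x \<in> K \<and> y \<in> T} = dim (UNIV :: (real ^ 'm) set)"
    by simp
  then have "{x + y |x y. x \<in> K \<and> y \<in> T} = UNIV"
    using subspace_dim_equal[OF subspace_sums[OF K sT] subspace_UNIV] by simp
  then obtain k x where "u = k + x" "k \<in> K" "x \<in> T"
    by blast
  then show ?thesis
    using that by (simp add: T_def)
qed

lemma is_pseudoinverse_unique:
  assumes H: "spd_matrix H" and L: "linear L"
    and M: "is_pseudoinverse H L M" and N: "is_pseudoinverse H L N"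
  shows "M = N"
proof -
  have pd: "x = 0" if "x \<bullet> (H *v x) = 0" for x
    using H that unfolding spd_matrix_def by force
  have eqH: "x = y" if "\<And>v. weighted_inner H x v = weighted_inner H y v" for x y
    using pd[of "x - y"] that[of "x - y"] by (simp add: weighted_inner_def inner_diff_left)
  have eqE: "x = y" if "\<And>v. x \<bullet> v = y \<bullet> v" for x y :: "real ^ 'b"
    using that vector_eq_rdot by blast
  have l: "L (M (L x)) = L x" "M (L (M y)) = M y" "L (N (L x)) = L x" "N (L (N y)) = N y" for x y
    using M N unfolding is_pseudoinverse_def by (metis comp_apply)+
  have aH: "weighted_inner H (M (L u)) v = weighted_inner H u (M (L v))"
    "weighted_inner H (N (L u)) v = weighted_inner H u (N (L v))" for u v
    using M N unfolding is_pseudoinverse_def self_adjoint_wrt_def by auto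
  have aE: "L (M x) \<bullet> y = x \<bullet> L (M y)" "L (N x) \<bullet> y = x \<bullet> L (N y)" for x y
    using M N unfolding is_pseudoinverse_def self_adjoint_wrt_def by auto
  have eq1: "M (L u) = N (L u)" for u
    by (rule eqH) (metis aH l)
  have eq2: "L (M y) = L (N y)" for y
    by (rule eqE) (metis aE l)
  show ?thesis
    by (rule ext) (metis eq1 eq2 l)
qed

lemma is_pseudoinverse_exists:
  fixes L :: "real ^ 'm::finite \<Rightarrow> real ^ 'k::finite"
  assumes H: "spd_matrix H" and L: "linear L"
  shows "\<exists>M. is_pseudoinverse H L M"
proof -
  have pd: "x = 0" if "x \<bullet> (H *v x) = 0" for x
    using H that unfolding spd_matrix_def by force
  define C where "C = {x. \<forall>s. L s = 0 \<longrightarrow> weighted_inner H s x = 0}"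
  define D where "D = {z. \<forall>u. L u \<bullet> z = 0}"
  have sC: "subspace C"
    by (auto simp: C_def subspace_def weighted_inner_def matrix_vector_right_distrib inner_add_right
        matrix_vector_mult_scaleR)
  have sD: "subspace D"
    by (auto simp: D_def subspace_def inner_add_right)
  have sym: "weighted_inner H u v = weighted_inner H v u" for u v
    using H by (metis spd_matrix_def weighted_inner_def dot_lmul_matrix
        vector_transpose_matrix inner_commute)
  have ex: "\<exists>x. x \<in> C \<and> y - L x \<in> D" for y
  proof -
    have R: "span (range L) = range L"
      using linear_subspace_image[OF L subspace_UNIV] by (simp only: span_eq_iff)
    obtain a z where a: "a \<in> range L" and z: "\<And>w. w \<in> range L \<Longrightarrow> orthogonal z w"
      and y: "y = a + z"
      using orthogonal_subspace_decomp_exists[of "range L" y] unfolding R by metis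
    have "z \<in> D"
      unfolding D_def using z[OF rangeI] by (simp add: orthogonal_def inner_commute)
    with a y obtain u where u: "y = L u + z" "z \<in> D"
      by blast
    have K: "subspace {s. L s = 0}"
      using linear_subspace_kernel[OF L] .
    obtain k x where kx: "u = k + x" "k \<in> {s. L s = 0}"
      and x: "\<And>s. s \<in> {s. L s = 0} \<Longrightarrow> weighted_inner H s x = 0"
      using weighted_orthogonal_decomposition[OF H K, of u] by blast
    have "x \<in> C"
      using x by (simp add: C_def)
    moreover have "y - L x \<in> D"
      using u kx by (simp add: linear_add[OF L])
    ultimately show ?thesis by blast
  qed
  have C0: "x = 0" if "x \<in> C" "L x = 0" for x
    using that pd by (auto simp: C_def weighted_inner_def)
  have un: "x = x'" if "x \<in> C" "y - L x \<in> D" "x' \<in> C" "y - L x' \<in> D" for x x' y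
  proof -
    have "L (x - x') \<in> D"
      using subspace_diff[OF sD that(4,2)] by (simp add: linear_diff[OF L])
    then have "L (x - x') = 0"
      unfolding D_def using inner_eq_zero_iff by blast
    then have "x - x' = 0"
      using C0 subspace_diff[OF sC that(1,3)] by blast
    then show ?thesis by simp
  qed
  obtain M where M: "M y \<in> C" "y - L (M y) \<in> D" for y
    using ex by metis
  have D: "L u \<bullet> (y - L (M y)) = 0" for u y
    using M(2)[of y] by (auto simp: D_def)
  have "linear M"
  proof (rule linearI)
    fix x y and c :: real
    show "M (x + y) = M x + M y"
    proof (rule un[where y = "x + y"])
      show "x + y - L (M x + M y) \<in> D"
        using subspace_add[OF sD M(2)[of x] M(2)[of y]] by (simp add: linear_add[OF L] algebra_simps)
    qed (use M subspace_add[OF sC] in auto)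
    show "M (c *\<^sub>R x) = c *\<^sub>R M x"
    proof (rule un[where y = "c *\<^sub>R x"])
      show "c *\<^sub>R x - L (c *\<^sub>R M x) \<in> D"
        using subspace_mul[OF sD M(2)[of x], of c] by (simp add: linear_cmul[OF L] algebra_simps)
    qed (use M subspace_mul[OF sC] in auto)
  qed
  have lml: "L (M (L x)) = L x" for x
    using D[of "x - M (L x)" "L x"] by (simp add: linear_diff[OF L])
  have mlm: "M (L (M y)) = M y" for y
    using C0[of "M (L (M y)) - M y"] M(1) subspace_diff[OF sC]
    by (simp add: linear_diff[OF L] lml)
  have aE: "L (M u) \<bullet> v = L (M u) \<bullet> L (M v)" for u v
    using D[of "M u" v] by (simp add: inner_diff_right)
  have aH: "weighted_inner H u (M y) = weighted_inner H (M (L u)) (M y)" for u y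
  proof -
    have "weighted_inner H (u - M (L u)) (M y) = 0"
      using M(1)[of y] by (auto simp: C_def linear_diff[OF L] lml)
    then show ?thesis by (simp add: weighted_inner_def inner_diff_left)
  qed
  have "is_pseudoinverse H L M"
    unfolding is_pseudoinverse_def self_adjoint_wrt_def
    using \<open>linear M\<close> lml mlm aE aH sym by (auto simp: fun_eq_iff) (metis inner_commute)+
  then show ?thesis by blast
qed

lemma is_pseudoinverse_pseudoinverse:
  assumes "spd_matrix H" and "linear L"
  shows "is_pseudoinverse H L (pseudoinverse H L)"
  unfolding pseudoinverse_def
  using is_pseudoinverse_exists[OF assms] is_pseudoinverse_unique[OF assms]
  by (metis (mono_tags, lifting) theI)

end

theory Submission
  imports Defs
begin

text \<open>
  Put \<open>E = I - P = L\<^sup>+ L\<close>. The identity \<open>L L\<^sup>+ L = L\<close> makes \<open>E\<close> idempotent, so that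
  \<open>P E = E P = 0\<close>, and \<open>L gt = g\<close> gives \<open>L\<^sup>+ g = E gt\<close> for \<open>t \<ge> 0\<close>, where \<open>gt\<close> is the lift of the
  boundary data. In these terms the comparison of the projected problem (A) with the simplified
  problem (B) is a statement about a bounded idempotent on a Banach space.

  The projection \<open>E\<close> removes the spatial operator from both equations. Applied to (A) it leaves
  \<open>(E (v - gt))\<^sub>t = 0\<close>, and compatibility of the initial data gives \<open>E (v - gt) = 0\<close> at \<open>t = 0\<close>;
  hence \<open>E v = E gt\<close> for all \<open>t\<close>, which says that \<open>v = P v + E gt\<close>
  (\<open>solves_projected_boundary\<close>). Applied to (B) it leaves \<open>(E w)\<^sub>t = 0\<close> with \<open>E w = 0\<close> at \<open>t = 0\<close>;
  hence \<open>w = P w\<close> (\<open>solves_simplified_range\<close>). In turn, \<open>P\<close> removes the boundary forcing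
  \<open>E gt\<^sub>t\<close>, so applying \<open>P\<close> to (A) gives (B), while \<open>w = P w\<close> shows that adding \<open>E gt\<close> to a solution
  of (B) gives a solution of (A).
\<close>

lemma regular_in_time_derivative:
  assumes "regular_in_time u" "t > 0"
  shows "(u has_vector_derivative vector_derivative u (at t)) (at t)"
  using assms by (simp add: regular_in_time_def vector_derivative_works)

lemma regular_in_time_bounded_linear:
  assumes A: "bounded_linear A" and u: "regular_in_time u"
  shows "regular_in_time (\<lambda>t. A (u t))"
    and "t > 0 \<Longrightarrow> vector_derivative (\<lambda>t. A (u t)) (at t) = A (vector_derivative u (at t))"
proof -
  have d: "((\<lambda>t. A (u t)) has_vector_derivative A (vector_derivative u (at t))) (at t)"
    if "t > 0" for t
    using bounded_linear.has_vector_derivative[OF A regular_in_time_derivative[OF u that]] .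
  then show "t > 0 \<Longrightarrow> vector_derivative (\<lambda>t. A (u t)) (at t) = A (vector_derivative u (at t))"
    by (rule vector_derivative_at)
  show "regular_in_time (\<lambda>t. A (u t))"
    using u d unfolding regular_in_time_def
    by (auto intro: bounded_linear.continuous_on[OF A] differentiableI_vector)
qed

lemma regular_in_time_add:
  assumes u: "regular_in_time u" and v: "regular_in_time v"
  shows "regular_in_time (\<lambda>t. u t + v t)"
    and "t > 0 \<Longrightarrow> vector_derivative (\<lambda>t. u t + v t) (at t) =
           vector_derivative u (at t) + vector_derivative v (at t)"
proof -
  show "regular_in_time (\<lambda>t. u t + v t)"
    using u v by (auto simp: regular_in_time_def intro: continuous_on_add)
  show "t > 0 \<Longrightarrow> vector_derivative (\<lambda>t. u t + v t) (at t) =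
          vector_derivative u (at t) + vector_derivative v (at t)"
    using u v by (intro vector_derivative_at has_vector_derivative_add regular_in_time_derivative)
qed

text \<open>
  Values at negative times are arbitrary, but the derivative at a time \<open>t > 0\<close> depends only
  on values at nearby, hence positive, times.
\<close>

lemma regular_in_time_cong:
  assumes u: "regular_in_time u" and eq: "\<And>t. t \<ge> 0 \<Longrightarrow> u t = v t"
  shows "regular_in_time v"
    and "t > 0 \<Longrightarrow> vector_derivative v (at t) = vector_derivative u (at t)"
proof -
  have d: "(v has_vector_derivative vector_derivative u (at t)) (at t)" if "t > 0" for t
    using regular_in_time_derivative[OF u that]
    by (rule has_vector_derivative_transform_within_open[where S = "{0<..}"])
      (use that eq in auto)
  then show "t > 0 \<Longrightarrow> vector_derivative v (at t) = vector_derivative u (at t)"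
    by (rule vector_derivative_at)
  have "continuous_on {0..} v"
    using u eq continuous_on_cong[of "{0..}" "{0..}" u v] by (simp add: regular_in_time_def)
  then show "regular_in_time v"
    using d unfolding regular_in_time_def by (auto intro: differentiableI_vector)
qed

text \<open>
  Solutions need not be differentiable at the initial time, so the mean value argument treats
  \<open>t = 0\<close> as an exceptional point at which continuity suffices.
\<close>

lemma regular_in_time_constant:
  fixes u :: "real \<Rightarrow> 'a::banach"
  assumes u: "regular_in_time u"
    and 0: "\<And>t. t > 0 \<Longrightarrow> vector_derivative u (at t) = 0"
    and t: "t \<ge> 0"
  shows "u t = u 0"
proof (rule has_derivative_zero_unique_strong_convex[where S = "{0..}" and K = "{0}"])
  show "(u has_derivative (\<lambda>h. 0)) (at s within {0..})" if "s \<in> {0..} - {0}" for s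
    using regular_in_time_derivative[OF u, of s] 0[of s] that
    by (auto simp: has_vector_derivative_def intro: has_derivative_at_withinI)
qed (use u t in \<open>auto simp: regular_in_time_def\<close>)

text \<open>
  The component of \<open>v\<close> in the range of \<open>E\<close> is determined by the boundary data alone: applying \<open>E\<close>
  to (A) removes \<open>Q\<close> and leaves \<open>(E v)\<^sub>t = (E gt)\<^sub>t\<close>.
\<close>

lemma solves_projected_boundary:
  fixes E :: "'a::banach \<Rightarrow> 'a"
  assumes E: "bounded_linear E" and idem: "\<And>x. E (E x) = E x"
    and gt: "regular_in_time gt" and f: "E f = E (gt 0)"
    and v: "solves_projected (\<lambda>u. u - E u) Q gt f v"
    and t: "t \<ge> 0"
  shows "E (v t) = E (gt t)"
proof -
  interpret E: bounded_linear E by (rule E)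
  have rv: "regular_in_time v" and v0: "v 0 = f"
    using v by (auto simp: solves_projected_def)
  have B: "bounded_linear (\<lambda>x. - E x)"
    by (rule bounded_linear_minus[OF E])
  note r = regular_in_time_bounded_linear[OF E rv] regular_in_time_bounded_linear[OF B gt]
  have "E (v t) + - E (gt t) = E (v 0) + - E (gt 0)"
  proof (rule regular_in_time_constant[OF _ _ t])
    show "regular_in_time (\<lambda>t. E (v t) + - E (gt t))"
      by (rule regular_in_time_add[OF r(1,3)])
    fix s :: real assume s: "s > 0"
    let ?v' = "vector_derivative v (at s)" and ?g' = "vector_derivative gt (at s)"
    obtain q where "?v' + (q - E q) = E ?g'"
      using v s by (auto simp: solves_projected_def)
    then have "E (?v' + (q - E q)) = E (E ?g')" by simp
    then have "E ?v' = E ?g'" by (simp add: E.add E.diff idem)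
    then show "vector_derivative (\<lambda>t. E (v t) + - E (gt t)) (at s) = 0"
      using regular_in_time_add(2)[OF r(1,3) s] r(2,4)[OF s] by simp
  qed
  then show ?thesis using v0 f by simp
qed

lemma solves_projected_imp_simplified:
  fixes E :: "'a::banach \<Rightarrow> 'a"
  assumes E: "bounded_linear E" and idem: "\<And>x. E (E x) = E x"
    and g: "\<And>t. t \<ge> 0 \<Longrightarrow> Lp (g t) = E (gt t)"
    and v: "solves_projected (\<lambda>u. u - E u) Q gt f v"
  shows "solves_simplified (\<lambda>u. u - E u) Q Lp g f (\<lambda>t. v t - E (v t))"
proof -
  interpret E: bounded_linear E by (rule E)
  have P: "bounded_linear (\<lambda>u. u - E u)"
    by (rule bounded_linear_sub[OF bounded_linear_ident E])
  have rv: "regular_in_time v" and v0: "v 0 = f"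
    using v by (auto simp: solves_projected_def)
  note r = regular_in_time_bounded_linear[OF P rv]
  have "vector_derivative (\<lambda>t. v t - E (v t)) (at t) +
      (Q (v t - E (v t) + Lp (g t)) - E (Q (v t - E (v t) + Lp (g t)))) = 0" if t: "t > 0" for t
  proof -
    define q where "q = Q (v t - E (v t) + Lp (g t))"
    let ?v' = "vector_derivative v (at t)" and ?g' = "vector_derivative gt (at t)"
    have "?v' + (q - E q) = E ?g'"
      using v t g[of t] by (auto simp: solves_projected_def q_def)
    then have "?v' = E ?g' - (q - E q)" by (simp add: eq_diff_eq)
    then have "?v' - E ?v' = - (q - E q)" by (simp add: E.diff idem)
    then show ?thesis using r(2)[OF t] by (simp add: q_def)
  qed
  then show ?thesis
    using r(1) v0 by (simp add: solves_simplified_def)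
qed

lemma solves_simplified_range:
  fixes E :: "'a::banach \<Rightarrow> 'a"
  assumes E: "bounded_linear E" and idem: "\<And>x. E (E x) = E x"
    and w: "solves_simplified (\<lambda>u. u - E u) Q Lp g f w"
    and t: "t \<ge> 0"
  shows "E (w t) = 0"
proof -
  interpret E: bounded_linear E by (rule E)
  have rw: "regular_in_time w" and w0: "w 0 = f - E f"
    using w by (auto simp: solves_simplified_def)
  note r = regular_in_time_bounded_linear[OF E rw]
  have "E (w t) = E (w 0)"
  proof (rule regular_in_time_constant[OF r(1) _ t])
    fix s :: real assume s: "s > 0"
    obtain q where "vector_derivative w (at s) + (q - E q) = 0"
      using w s by (auto simp: solves_simplified_def)
    then have "vector_derivative w (at s) = E q - q" by (simp add: algebra_simps eq_neg_iff_add_eq_0)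
    then show "vector_derivative (\<lambda>t. E (w t)) (at s) = 0"
      using r(2)[OF s] by (simp add: E.diff idem)
  qed
  then show ?thesis by (simp add: w0 E.diff idem)
qed

text \<open>
  The added term \<open>Lp g\<close> is regular because for \<open>t \<ge> 0\<close> it is \<open>E gt\<close>; its derivative \<open>E gt\<^sub>t\<close> is
  exactly the right-hand side of (A). The argument of \<open>Q\<close> is the same in both equations since
  \<open>E w = 0\<close> and \<open>E (E gt) = E gt\<close>.
\<close>

lemma solves_simplified_imp_projected:
  fixes E :: "'a::banach \<Rightarrow> 'a"
  assumes E: "bounded_linear E" and idem: "\<And>x. E (E x) = E x"
    and gt: "regular_in_time gt" and f: "E f = E (gt 0)"
    and g: "\<And>t. t \<ge> 0 \<Longrightarrow> Lp (g t) = E (gt t)"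
    and w: "solves_simplified (\<lambda>u. u - E u) Q Lp g f w"
  shows "solves_projected (\<lambda>u. u - E u) Q gt f (\<lambda>t. w t + Lp (g t))"
proof -
  interpret E: bounded_linear E by (rule E)
  have rw: "regular_in_time w" and w0: "w 0 = f - E f"
    using w by (auto simp: solves_simplified_def)
  note rE = regular_in_time_bounded_linear[OF E gt]
  note rg = regular_in_time_cong[where v = "\<lambda>t. Lp (g t)", OF rE(1) g[symmetric]]
  note r = regular_in_time_add[OF rw rg(1)]
  have "vector_derivative (\<lambda>t. w t + Lp (g t)) (at t) +
      (Q (w t + Lp (g t)) - E (Q (w t + Lp (g t)))) = E (vector_derivative gt (at t))"
    if t: "t > 0" for t
    using w t r(2)[OF _ t] rg(2)[OF _ t] rE(2)[OF t] by (simp add: solves_simplified_def)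
  moreover have "w t + Lp (g t) - E (w t + Lp (g t)) + (gt t - (gt t - E (gt t))) =
      w t + Lp (g t)" if t: "t > 0" for t
    using t solves_simplified_range[OF E idem w, of t] g[of t] by (simp add: E.add idem)
  ultimately show ?thesis
    using r(1) w0 f g[of 0] by (simp add: solves_projected_def)
qed

theorem theorem49:
  fixes H :: "real ^ ('n::finite \<times> 'd::finite) ^ ('n \<times> 'd)"
    and L :: "('n, 'd) state \<Rightarrow> 'd bstate"
    and Q P :: "('n, 'd) state \<Rightarrow> ('n, 'd) state"
    and Lp :: "'d bstate \<Rightarrow> ('n, 'd) state"
    and g :: "real \<Rightarrow> 'd bstate"
    and gt :: "real \<Rightarrow> ('n, 'd) state"
    and f :: "('n, 'd) state"
  assumes "spd_matrix H"
    and "linear L"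
    and "Lp = pseudoinverse H L"
    and "P = (\<lambda>u. u - Lp (L u))"
    and "linear Q"
    and "regular_in_time gt"
    and "\<forall>t\<ge>0. L (gt t) = g t"
    and "L f = g 0"
  shows "(\<forall>v. solves_projected P Q gt f v \<longrightarrow>
            solves_simplified P Q Lp g f (\<lambda>t. P (v t)) \<and>
            (\<forall>t\<ge>0. v t = P (v t) + Lp (g t))) \<and>
         (\<forall>w. solves_simplified P Q Lp g f w \<longrightarrow>
            (\<forall>t\<ge>0. w t = P (w t)) \<and>
            solves_projected P Q gt f (\<lambda>t. w t + Lp (g t)))"
proof -
  define E where "E = (\<lambda>u. Lp (L u))"
  have pinv: "is_pseudoinverse H L Lp"
    using is_pseudoinverse_pseudoinverse assms(1-3) by metis
  have "linear Lp" and LLpL: "L (Lp (L u)) = L u" for u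
    using pinv unfolding is_pseudoinverse_def by (auto simp: fun_eq_iff)
  then have E: "bounded_linear E"
    using linear_compose[OF assms(2), of Lp] by (simp add: E_def o_def linear_conv_bounded_linear)
  have idem: "E (E x) = E x" for x
    by (simp add: E_def LLpL)
  have g: "Lp (g t) = E (gt t)" if "t \<ge> 0" for t
    using that assms(7) by (simp add: E_def)
  have f: "E f = E (gt 0)"
    using assms(7,8) by (simp add: E_def)
  have P: "P = (\<lambda>u. u - E u)"
    by (simp add: assms(4) E_def)
  note gt = assms(6)
  show ?thesis
    unfolding P
  proof (intro conjI allI impI)
    fix v assume v: "solves_projected (\<lambda>u. u - E u) Q gt f v"
    show "solves_simplified (\<lambda>u. u - E u) Q Lp g f (\<lambda>t. v t - E (v t))"
      using E idem g v by (rule solves_projected_imp_simplified)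
    show "v t = v t - E (v t) + Lp (g t)" if "t \<ge> 0" for t
      using solves_projected_boundary[OF E idem gt f v that] g[OF that] by simp
  next
    fix w assume w: "solves_simplified (\<lambda>u. u - E u) Q Lp g f w"
    show "w t = w t - E (w t)" if "t \<ge> 0" for t
      using solves_simplified_range[OF E idem w that] by simp
    show "solves_projected (\<lambda>u. u - E u) Q gt f (\<lambda>t. w t + Lp (g t))"
      using E idem gt f g w by (rule solves_simplified_imp_projected)
  qed
qed

end
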